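(* Let $n\ge 2$ and let $\mathbf{A}=[a_{ij}]$ be an $n\times n$ reciprocal pairwise comparison matrix with Koczkodaj's inconsistency index $KI(\mathbf{A})$, put $\kappa=1-KI(\mathbf{A})$ and $K=\frac{1}{\kappa^2}-1$. Let $w^{EV}$ and $w^{GM}$ be the normalized priority vectors of the $n$ compared objects obtained from $\mathbf{A}$ by the eigenvalue method and by the geometric mean method, respectively, and let $O^{EV}$ and $O^{GM}$ be the corresponding ordinal rankings of all objects from the best to the worst, both assumed to be without ties. Number the objects so that $w_1^{EV}>w_2^{EV}>\dots>w_n^{EV}$ and let $d=\min_{1\le i\le n-1}(w_i^{EV}-w_{i+1}^{EV})$ be the smallest difference between adjacent eigenvalue-method weights. Let $k$ be an integer such that $0\le k\le\binom{n}{2}$, $k\cdot d<K$ and $(k+1)\cdot d>K$. Then $$\rho(O^{EV},O^{GM})\ge 1-\frac{6(k^2+k)}{n(n^2-1)},$$ where $\rho$ is Spearman's rank correlation coefficient.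
   Context: A pairwise comparison (PC) matrix of $n$ objects is an $n\times n$ real matrix $\mathbf{A}=[a_{ij}]$ with $a_{ij}>0$ and $a_{ii}=1$; it is reciprocal if $a_{ij}=1/a_{ji}$ for all $i,j$. All PC matrices are assumed reciprocal. Koczkodaj's inconsistency index is $$KI(\mathbf{A})=\max\left\{1-\min\left\{\frac{a_{ij}}{a_{ik}a_{kj}},\frac{a_{ik}a_{kj}}{a_{ij}}\right\} : i,j,k\in\{1,\dots,n\}\right\},$$ so $0\le KI(\mathbf{A})<1$. Eigenvalue (EV) method: $w^{EV}$ is the positive vector with $\mathbf{A}w^{EV}=\lambda_{\max}w^{EV}$, where $\lambda_{\max}$ is the largest (Perron–Frobenius) eigenvalue of $\mathbf{A}$, normalized so that $\sum_i w_i^{EV}=1$. Geometric mean (GM) method: $w_i^{GM}=\left(\prod_{k=1}^n a_{ik}\right)^{1/n}\Big/\sum_{j=1}^n\left(\prod_{k=1}^n a_{jk}\right)^{1/n}$, so $\sum_i w_i^{GM}=1$. The ordinal ranking given by a priority vector orders the objects by decreasing weight; rankings are assumed to contain no ties (they are total orders). Spearman's $\rho$: for two rankings $X,Y$ without ties of $n$ objects, let $\delta_i$ be the difference between the rank of object $i$ in $X$ and its rank in $Y$. Then $\rho(X,Y)=1-\dfrac{6\sum_{i=1}^n\delta_i^2}{n(n^2-1)}$. *)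

theory Defs
  imports "Jordan_Normal_Form.Spectral_Radius"
begin

text \<open>The \<open>n\<close> objects are the indices \<open>0, \<dots>, n - 1\<close> of the matrices and vectors.\<close>

definition reciprocal_pc_matrix :: "nat \<Rightarrow> real mat \<Rightarrow> bool" where
  "reciprocal_pc_matrix n A \<longleftrightarrow>
     A \<in> carrier_mat n n \<and>
     (\<forall>i<n. \<forall>j<n. A $$ (i, j) > 0) \<and>
     (\<forall>i<n. A $$ (i, i) = 1) \<and>
     (\<forall>i<n. \<forall>j<n. A $$ (i, j) = 1 / A $$ (j, i))"

definition koczkodaj_index :: "nat \<Rightarrow> real mat \<Rightarrow> real" where
  "koczkodaj_index n A = Max {1 - min (A $$ (i, j) / (A $$ (i, k) * A $$ (k, j)))
                                      (A $$ (i, k) * A $$ (k, j) / A $$ (i, j)) |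
                              i j k. i < n \<and> j < n \<and> k < n}"

text \<open>The largest real eigenvalue. For the entrywise positive matrices considered here, the
  Perron-Frobenius theorem says that this is the Perron root, i.e. the spectral radius.\<close>

definition lambda_max :: "real mat \<Rightarrow> real" where
  "lambda_max A = Max (spectrum A)"

text \<open>By the Perron-Frobenius theorem, exactly one vector \<open>w\<close> satisfies this predicate if \<open>A\<close> is a
  reciprocal pairwise comparison matrix and \<open>n > 0\<close>.\<close>

definition is_ev_vector :: "nat \<Rightarrow> real mat \<Rightarrow> real vec \<Rightarrow> bool" where
  "is_ev_vector n A w \<longleftrightarrow>
     w \<in> carrier_vec n \<and>
     (\<forall>i<n. w $ i > 0) \<and>
     eigenvector A w (lambda_max A) \<and>
     (\<Sum>i<n. w $ i) = 1"

definition gm_vector :: "nat \<Rightarrow> real mat \<Rightarrow> real vec" where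
  "gm_vector n A = vec n (\<lambda>i. root n (\<Prod>k<n. A $$ (i, k)) /
                              (\<Sum>j<n. root n (\<Prod>k<n. A $$ (j, k))))"

definition no_ties :: "nat \<Rightarrow> real vec \<Rightarrow> bool" where
  "no_ties n w \<longleftrightarrow> inj_on (\<lambda>i. w $ i) {..<n}"

text \<open>A ranking is represented by the function sending each object to its rank; rank \<open>1\<close> is the
  best. If \<open>w\<close> has no ties, this is a bijection from \<open>{..<n}\<close> to \<open>{1..n}\<close>.\<close>

definition ordinal_ranking :: "nat \<Rightarrow> real vec \<Rightarrow> nat \<Rightarrow> nat" where
  "ordinal_ranking n w i = card {j. j < n \<and> w $ j > w $ i} + 1"

definition spearman_rho :: "nat \<Rightarrow> (nat \<Rightarrow> nat) \<Rightarrow> (nat \<Rightarrow> nat) \<Rightarrow> real" where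
  "spearman_rho n X Y =
     1 - 6 * (\<Sum>i<n. (real (X i) - real (Y i))\<^sup>2) / (real n * ((real n)\<^sup>2 - 1))"

text \<open>\<open>\<pi> i\<close> is the object that gets number \<open>i\<close>, so \<open>w $ \<pi> 1 > \<dots> > w $ \<pi> n\<close>.\<close>

definition decreasing_numbering :: "nat \<Rightarrow> real vec \<Rightarrow> (nat \<Rightarrow> nat) \<Rightarrow> bool" where
  "decreasing_numbering n w \<pi> \<longleftrightarrow>
     bij_betw \<pi> {1..n} {..<n} \<and> (\<forall>i\<in>{1..n - 1}. w $ \<pi> i > w $ \<pi> (i + 1))"

end

theory Submission
  imports Defs
begin

text \<open>Write \<open>w\<close> for the eigenvalue vector, \<open>g\<close> for the geometric mean vector, \<open>\<delta>\<^sub>i\<close> for the rank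
  difference of object \<open>i\<close>. The claim is \<open>\<Sum>\<^sub>i \<delta>\<^sub>i\<^sup>2 \<le> k\<^sup>2 + k\<close>. Two estimates of the Euclidean distance
  between \<open>w\<close> and \<open>g\<close> give it: closeness of the two methods bounds that distance from above, and rank
  differences bound it from below.

  Upper bound. The eigenvector ratio \<open>w\<^sub>i / w\<^sub>j\<close> is at least \<open>\<kappa> a\<^sub>i\<^sub>j\<close>, and the geometric mean ratio
  \<open>g\<^sub>i / g\<^sub>j\<close> is at most \<open>a\<^sub>i\<^sub>j / \<kappa>\<close>, because the rows \<open>i\<close> and \<open>j\<close> of the matrix are proportional up to
  a factor \<open>\<kappa>\<close>. So the quotients \<open>g\<^sub>i / w\<^sub>i\<close> differ from each other by a factor of at most
  \<open>R = 1 / \<kappa>\<^sup>2 = K + 1\<close> (\<open>gm_ev_cross_ratio\<close>). As both vectors have sum \<open>1\<close>, the mass that \<open>g\<close> has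
  in excess of \<open>w\<close> is at most \<open>(R - 1) / 4 = K / 4\<close> (\<open>sum_excess_le\<close>), and the missing mass is the
  same; hence \<open>\<Sum>\<^sub>i (g\<^sub>i - w\<^sub>i)\<^sup>2 \<le> 2 (K / 4)\<^sup>2 = K\<^sup>2 / 8\<close> (\<open>sum_square_ev_gm_le\<close>). The constant matters:
  the more obvious bound \<open>K\<close> on the Manhattan distance loses a factor of two against this one, which
  the final step cannot afford.

  Lower bound. Let \<open>v\<close> be the rearrangement of the values of \<open>w\<close> that ranks the objects as \<open>g\<close> does.
  Among all rearrangements of \<open>w\<close> it is the one closest to \<open>g\<close>, by the rearrangement inequality; so \<open>v\<close>
  is at least as close to \<open>g\<close> as \<open>w\<close> is. By the triangle inequality, \<open>w\<close> and \<open>v\<close> are at most twice as far apart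
  as \<open>w\<close> and \<open>g\<close>. But \<open>w\<^sub>i\<close> and \<open>v\<^sub>i\<close> are entries of one decreasing sequence with gaps of at least \<open>d\<close>,
  in positions that differ by \<open>\<delta>\<^sub>i\<close>. This yields
  \<open>d\<^sup>2 \<Sum>\<^sub>i \<delta>\<^sub>i\<^sup>2 \<le> 4 \<Sum>\<^sub>i (g\<^sub>i - w\<^sub>i)\<^sup>2\<close> (\<open>rank_displacement_le\<close>).

  Together, \<open>d\<^sup>2 \<Sum>\<^sub>i \<delta>\<^sub>i\<^sup>2 \<le> K\<^sup>2 / 2 < ((k + 1) d)\<^sup>2 / 2\<close>, that is \<open>\<Sum>\<^sub>i \<delta>\<^sub>i\<^sup>2 < (k + 1)\<^sup>2 / 2\<close>. The right-hand
  side is at most \<open>k\<^sup>2 + k\<close> if \<open>k \<ge> 1\<close>, and for \<open>k = 0\<close> the integer on the left is \<open>0\<close>.\<close>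

section \<open>The rearrangement inequality\<close>

text \<open>If \<open>p\<close> moves the point \<open>m\<close> where \<open>c\<close>, and with it \<open>b\<close>, is largest, then following \<open>p\<close> by the
  transposition of \<open>m\<close> and \<open>p m\<close> does not decrease the sum, and the new bijection fixes \<open>m\<close>; the rest
  is a smaller instance. The hypothesis excludes different values of \<open>b\<close> at ties of \<open>c\<close>, which makes
  any maximum point of \<open>c\<close> a maximum point of \<open>b\<close>.\<close>

lemma rearrangement_inequality:
  fixes b c :: "'a \<Rightarrow> real"
  assumes "finite S" and "bij_betw p S S"
    and "\<And>i j. i \<in> S \<Longrightarrow> j \<in> S \<Longrightarrow> c i \<le> c j \<Longrightarrow> b i \<le> b j"
  shows "(\<Sum>i\<in>S. c i * b (p i)) \<le> (\<Sum>i\<in>S. c i * b i)"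
  using assms
proof (induction "card S" arbitrary: S p)
  case 0
  then show ?case by simp
next
  case (Suc N)
  have "S \<noteq> {}" using Suc.hyps(2) by auto
  then have "Max (c ` S) \<in> c ` S"
    using Suc.prems(1) by (intro Max_in) auto
  then obtain m where "m \<in> S" "c m = Max (c ` S)" by auto
  then have m: "m \<in> S" "\<And>i. i \<in> S \<Longrightarrow> c i \<le> c m"
    using Suc.prems(1) by auto
  define a where "a = inv_into S p m"
  have a: "a \<in> S" "p a = m"
    using Suc.prems(2) m(1) unfolding a_def
    by (auto simp: bij_betw_def inv_into_into f_inv_into_f)
  have pm: "p m \<in> S" using Suc.prems(2) m(1) by (auto simp: bij_betw_def)
  have inj: "p i = p j \<longleftrightarrow> i = j" if "i \<in> S" "j \<in> S" for i j
    using Suc.prems(2) that by (auto simp: bij_betw_def inj_on_def)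
  define q where "q = transpose m (p m) \<circ> p"
  have q_other: "q i = p i" if "i \<in> S" "i \<noteq> m" "i \<noteq> a" for i
    using inj[OF that(1) m(1)] inj[OF that(1) a(1)] a(2) that
    by (simp add: q_def transpose_def)
  have q_m: "q m = m" by (simp add: q_def)
  have q_a: "q a = p m" by (simp add: q_def a(2))
  have "bij_betw (transpose m (p m)) S S"
    using m(1) pm by (simp add: bij_betw_transpose_iff)
  then have "bij_betw q S S"
    unfolding q_def using Suc.prems(2) by (rule bij_betw_trans[rotated])
  then have q_bij: "bij_betw q (S - {m}) (S - {m})"
    using q_m m(1) by (metis bij_betw_DiffI bij_betw_singletonI empty_subsetI insert_subset)
  have swap: "(\<Sum>i\<in>S. c i * b (p i)) \<le> (\<Sum>i\<in>S. c i * b (q i))"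
  proof (cases "a = m")
    case True
    then show ?thesis using q_other q_m a(2)
      by (intro sum_mono) (metis order.refl)
  next
    case False
    have split: "(\<Sum>i\<in>S. f i) = f m + (f a + (\<Sum>i\<in>S - {m} - {a}. f i))" for f :: "'a \<Rightarrow> real"
      using False m(1) a(1) Suc.prems(1)
      by (simp add: sum.remove[of S m] sum.remove[of "S - {m}" a])
    have "b (p m) \<le> b m" using m pm Suc.prems(3) by blast
    then have "0 \<le> (c m - c a) * (b m - b (p m))"
      using m(2)[OF a(1)] by simp
    then have "c m * b (p m) + c a * b m \<le> c m * b m + c a * b (p m)"
      by (simp add: algebra_simps)
    then show ?thesis
      unfolding split by (simp add: q_m q_a a(2) q_other)
  qed
  have "(\<Sum>i\<in>S - {m}. c i * b (q i)) \<le> (\<Sum>i\<in>S - {m}. c i * b i)"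
  proof (rule Suc.hyps(1))
    show "N = card (S - {m})" using Suc.hyps(2) Suc.prems(1) m(1) by simp
  qed (use Suc.prems q_bij in auto)
  then have "(\<Sum>i\<in>S. c i * b (q i)) \<le> (\<Sum>i\<in>S. c i * b i)"
    using Suc.prems(1) m(1) by (simp add: sum.remove[of S m] q_m)
  with swap show ?case by linarith
qed

text \<open>The two sums of squares differ only in their mixed terms, since a bijection preserves the sum
  of the squares of \<open>b\<close>.\<close>

corollary rearrangement_inequality_squares:
  fixes b c :: "'a \<Rightarrow> real"
  assumes "finite S" and p: "bij_betw p S S"
    and "\<And>i j. i \<in> S \<Longrightarrow> j \<in> S \<Longrightarrow> c i \<le> c j \<Longrightarrow> b i \<le> b j"
  shows "(\<Sum>i\<in>S. (c i - b i)\<^sup>2) \<le> (\<Sum>i\<in>S. (c i - b (p i))\<^sup>2)"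
proof -
  have "(\<Sum>i\<in>S. (b (p i))\<^sup>2) = (\<Sum>i\<in>S. (b i)\<^sup>2)"
    by (rule sum.reindex_bij_betw[OF p])
  moreover have "(\<Sum>i\<in>S. c i * b (p i)) \<le> (\<Sum>i\<in>S. c i * b i)"
    using assms by (rule rearrangement_inequality)
  ultimately show ?thesis
    by (simp add: power2_diff sum.distrib sum_subtractf mult.assoc flip: sum_distrib_left)
qed

section \<open>Normalized vectors with bounded mutual ratios\<close>

text \<open>Summing the hypothesis over \<open>i \<in> P\<close> and \<open>j \<in> S - P\<close> reduces the claim to two points. If \<open>P\<close>
  has \<open>v\<close>-mass \<open>V\<close> and \<open>u\<close>-mass \<open>V + T\<close>, the result is \<open>(V + T) (1 - V) \<le> R V (1 - V - T)\<close>, which rearranges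
  to \<open>T (1 + (R - 1) V) \<le> (R - 1) V (1 - V)\<close>; and \<open>V (1 - V) \<le> 1/4\<close>.\<close>

lemma sum_excess_le:
  fixes u v :: "'a \<Rightarrow> real"
  assumes fin: "finite S"
    and sum_u: "sum u S = 1" and sum_v: "sum v S = 1"
    and nonneg_v: "\<And>i. i \<in> S \<Longrightarrow> 0 \<le> v i"
    and "1 \<le> R"
    and ratio: "\<And>i j. i \<in> S \<Longrightarrow> j \<in> S \<Longrightarrow> u i * v j \<le> R * (v i * u j)"
    and "P \<subseteq> S"
  shows "(\<Sum>i\<in>P. u i - v i) \<le> (R - 1) / 4"
proof -
  define V where "V = sum v P"
  define T where "T = (\<Sum>i\<in>P. u i - v i)"
  have sum_uP: "sum u P = V + T" by (simp add: V_def T_def sum_subtractf)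
  have compl: "sum f (S - P) = sum f S - sum f P" for f :: "'a \<Rightarrow> real"
    using fin \<open>P \<subseteq> S\<close> by (simp add: sum_diff)
  have V: "0 \<le> V" "V \<le> 1"
    unfolding V_def using nonneg_v \<open>P \<subseteq> S\<close> fin sum_v
    by (auto intro: sum_nonneg) (metis sum_mono2 DiffD1)
  have "sum u P * sum v (S - P) \<le> R * (sum v P * sum u (S - P))"
    unfolding sum_product[of u P] sum_product[of v P] sum_distrib_left[of R]
    using ratio \<open>P \<subseteq> S\<close> by (intro sum_mono) auto
  then have "(V + T) * (1 - V) \<le> R * (V * (1 - V - T))"
    by (simp add: compl sum_uP sum_u sum_v V_def algebra_simps)
  then have *: "T * (1 + (R - 1) * V) \<le> (R - 1) * (V * (1 - V))"
    by (simp add: algebra_simps)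
  have quarter: "V * (1 - V) \<le> 1 / 4"
    using zero_le_power2[of "V - 1 / 2"] by (simp add: power2_eq_square algebra_simps)
  have bound: "(R - 1) * (V * (1 - V)) \<le> (R - 1) / 4"
    using mult_left_mono[OF quarter, of "R - 1"] \<open>1 \<le> R\<close> by simp
  show ?thesis
  proof (cases "T \<le> 0")
    case True
    then show ?thesis using \<open>1 \<le> R\<close> by (simp add: T_def)
  next
    case False
    have "T * 1 \<le> T * (1 + (R - 1) * V)"
      using False V(1) \<open>1 \<le> R\<close> by (intro mult_left_mono) auto
    then show ?thesis using * bound unfolding T_def by linarith
  qed
qed

lemma sum_squares_le_square_sum:
  fixes f :: "'a \<Rightarrow> real"
  assumes "finite S" and "\<And>i. i \<in> S \<Longrightarrow> 0 \<le> f i"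
  shows "(\<Sum>i\<in>S. (f i)\<^sup>2) \<le> (sum f S)\<^sup>2"
proof -
  have "(f i)\<^sup>2 \<le> f i * sum f S" if "i \<in> S" for i
    unfolding power2_eq_square using that assms
    by (intro mult_left_mono member_le_sum) auto
  then have "(\<Sum>i\<in>S. (f i)\<^sup>2) \<le> (\<Sum>i\<in>S. f i * sum f S)"
    by (rule sum_mono)
  then show ?thesis by (simp add: power2_eq_square sum_distrib_right)
qed

text \<open>The positive and the negative part of \<open>u - v\<close> have the same mass \<open>T \<le> (R - 1) / 4\<close>, because both
  sums are \<open>1\<close>; each part contributes at most \<open>T\<^sup>2\<close> to the sum of squares.\<close>

lemma sum_square_differences_le:
  fixes u v :: "'a \<Rightarrow> real"
  assumes fin: "finite S"
    and sum_u: "sum u S = 1" and sum_v: "sum v S = 1"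
    and nonneg_v: "\<And>i. i \<in> S \<Longrightarrow> 0 \<le> v i"
    and R: "1 \<le> R"
    and ratio: "\<And>i j. i \<in> S \<Longrightarrow> j \<in> S \<Longrightarrow> u i * v j \<le> R * (v i * u j)"
  shows "(\<Sum>i\<in>S. (u i - v i)\<^sup>2) \<le> (R - 1)\<^sup>2 / 8"
proof -
  define P where "P = {i \<in> S. v i \<le> u i}"
  define T where "T = (\<Sum>i\<in>P. u i - v i)"
  have P: "P \<subseteq> S" and finP: "finite P" using fin by (auto simp: P_def)
  have split: "sum f S = sum f P + sum f (S - P)" for f :: "'a \<Rightarrow> real"
    using sum.subset_diff[OF P fin] by (simp add: add.commute)
  have T': "(\<Sum>i\<in>S - P. v i - u i) = T"
    using split[of u] split[of v] sum_u sum_v by (simp add: T_def sum_subtractf)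
  have "(\<Sum>i\<in>P. (u i - v i)\<^sup>2) \<le> T\<^sup>2"
    unfolding T_def using finP by (intro sum_squares_le_square_sum) (auto simp: P_def)
  moreover have "(\<Sum>i\<in>S - P. (u i - v i)\<^sup>2) \<le> T\<^sup>2"
    unfolding T'[symmetric] power2_commute[of "u _"]
    using fin by (intro sum_squares_le_square_sum) (auto simp: P_def)
  moreover have "T\<^sup>2 \<le> ((R - 1) / 4)\<^sup>2"
  proof (rule power_mono)
    show "T \<le> (R - 1) / 4"
      unfolding T_def using fin sum_u sum_v nonneg_v R ratio P by (rule sum_excess_le)
    show "0 \<le> T" unfolding T_def by (intro sum_nonneg) (auto simp: P_def)
  qed
  ultimately show ?thesis
    unfolding split by (simp add: power_divide)
qed

section \<open>Priority vectors and the inconsistency index\<close>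

text \<open>The reciprocity clause in the definition of \<open>reciprocal_pc_matrix\<close> rewrites entries to
  entries forever, so the simplifier should not see it; positivity is extracted once here.\<close>

lemma pc_matrix_pos:
  assumes "reciprocal_pc_matrix n A" and "i < n" and "j < n"
  shows "A $$ (i, j) > 0"
  using assms unfolding reciprocal_pc_matrix_def by blast

lemma koczkodaj_index_eq_Max_image:
  "koczkodaj_index n A = Max ((\<lambda>(i, j, k).
     1 - min (A $$ (i, j) / (A $$ (i, k) * A $$ (k, j))) (A $$ (i, k) * A $$ (k, j) / A $$ (i, j)))
       ` ({..<n} \<times> {..<n} \<times> {..<n}))"
  unfolding koczkodaj_index_def by (rule arg_cong[of _ _ Max]) force

text \<open>The index is a maximum over all triads, so \<open>\<kappa> = 1 - koczkodaj_index n A\<close> is the largest constant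
  such that, for positive entries, \<open>\<kappa> a\<^sub>i\<^sub>k a\<^sub>k\<^sub>j \<le> a\<^sub>i\<^sub>j\<close> and \<open>\<kappa> a\<^sub>i\<^sub>j \<le> a\<^sub>i\<^sub>k a\<^sub>k\<^sub>j\<close>
  throughout. The first inequality serves the eigenvalue method, the second one the geometric
  mean method.\<close>

lemma koczkodaj_index_triad:
  assumes "i < n" "j < n" "k < n"
  shows "1 - koczkodaj_index n A \<le> A $$ (i, j) / (A $$ (i, k) * A $$ (k, j))" (is ?t1)
    and "1 - koczkodaj_index n A \<le> A $$ (i, k) * A $$ (k, j) / A $$ (i, j)" (is ?t2)
proof -
  have "1 - min (A $$ (i, j) / (A $$ (i, k) * A $$ (k, j))) (A $$ (i, k) * A $$ (k, j) / A $$ (i, j))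
      \<le> koczkodaj_index n A"
    unfolding koczkodaj_index_eq_Max_image
    using assms by (intro Max_ge image_eqI[where x = "(i, j, k)"]) auto
  then show ?t1 ?t2 by auto
qed

lemma koczkodaj_index_less_one:
  assumes "reciprocal_pc_matrix n A" and "0 < n"
  shows "koczkodaj_index n A < 1"
proof -
  have "A $$ (a, b) > 0" if "a < n" "b < n" for a b
    using assms(1) that by (rule pc_matrix_pos)
  then show ?thesis
    unfolding koczkodaj_index_eq_Max_image using assms(2) by (subst Max_less_iff) auto
qed

text \<open>Row \<open>i\<close> dominates row \<open>j\<close> scaled by \<open>\<kappa> a\<^sub>i\<^sub>j\<close>. Applying both rows to \<open>w\<close> gives the inequality
  for \<open>\<lambda> w\<^sub>i\<close> and \<open>\<lambda> w\<^sub>j\<close>, where \<open>\<lambda> > 0\<close> because the matrix and \<open>w\<close> are positive.\<close>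

lemma ev_vector_ratio:
  assumes A: "reciprocal_pc_matrix n A" and w: "is_ev_vector n A w"
    and i: "i < n" and j: "j < n"
  shows "(1 - koczkodaj_index n A) * A $$ (i, j) * w $ j \<le> w $ i"
proof -
  define \<kappa> where "\<kappa> = 1 - koczkodaj_index n A"
  have pos: "A $$ (l, m) > 0" if "l < n" "m < n" for l m
    using A that by (rule pc_matrix_pos)
  have w_pos: "w $ l > 0" if "l < n" for l using w that by (simp add: is_ev_vector_def)
  have carr: "A \<in> carrier_mat n n" "w \<in> carrier_vec n"
    using A w unfolding reciprocal_pc_matrix_def is_ev_vector_def by blast+
  have eigen: "(\<Sum>m<n. A $$ (l, m) * w $ m) = lambda_max A * w $ l" if "l < n" for l
  proof -
    have "(A *\<^sub>v w) $ l = (lambda_max A \<cdot>\<^sub>v w) $ l"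
      using w by (simp add: is_ev_vector_def eigenvector_def)
    then show ?thesis
      using that carr by (simp add: scalar_prod_def atLeast0LessThan)
  qed
  have "0 < (\<Sum>m<n. A $$ (i, m) * w $ m)"
    using i pos w_pos by (intro sum_pos) auto
  then have lambda: "0 < lambda_max A"
    using eigen[OF i] w_pos[OF i] by (simp add: zero_less_mult_iff)
  have triad: "\<kappa> * A $$ (i, j) * A $$ (j, m) \<le> A $$ (i, m)" if "m < n" for m
    using koczkodaj_index_triad(1)[OF i that j, of A] pos i j that
    by (simp add: \<kappa>_def pos_le_divide_eq mult.assoc)
  have "lambda_max A * (\<kappa> * A $$ (i, j) * w $ j) = (\<Sum>m<n. \<kappa> * A $$ (i, j) * A $$ (j, m) * w $ m)"
    using eigen[OF j] by (simp add: mult.assoc mult.left_commute flip: sum_distrib_left)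
  also have "\<dots> \<le> (\<Sum>m<n. A $$ (i, m) * w $ m)"
    using triad w_pos by (intro sum_mono mult_right_mono) (auto simp: less_imp_le)
  also have "\<dots> = lambda_max A * w $ i" by (rule eigen[OF i])
  finally show ?thesis using lambda by (simp add: \<kappa>_def)
qed

lemma geometric_mean_pos:
  assumes "reciprocal_pc_matrix n A" and "i < n"
  shows "0 < root n (\<Prod>k<n. A $$ (i, k))"
proof -
  have "A $$ (i, k) > 0" if "k < n" for k
    using assms that by (intro pc_matrix_pos)
  then have "(\<Prod>k<n. A $$ (i, k)) > 0" by (intro prod_pos) auto
  then show ?thesis using assms(2) by simp
qed

lemma gm_vector_pos:
  assumes "reciprocal_pc_matrix n A" and "i < n"
  shows "gm_vector n A $ i > 0"
proof -
  have "root n (\<Prod>k<n. A $$ (j, k)) > 0" if "j < n" for j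
    using geometric_mean_pos[OF assms(1) that] .
  then show ?thesis
    using assms(2) by (auto simp: gm_vector_def intro!: divide_pos_pos sum_pos)
qed

lemma sum_gm_vector:
  assumes "reciprocal_pc_matrix n A" and "0 < n"
  shows "(\<Sum>i<n. gm_vector n A $ i) = 1"
proof -
  have "(\<Sum>j<n. root n (\<Prod>k<n. A $$ (j, k))) > 0"
    using assms(2) geometric_mean_pos[OF assms(1)] by (intro sum_pos) auto
  then show ?thesis by (simp add: gm_vector_def flip: sum_divide_distrib)
qed

text \<open>Here the opposite comparison of rows is used: row \<open>i\<close> scaled by \<open>\<kappa>\<close> is dominated by row \<open>j\<close>
  scaled by \<open>a\<^sub>i\<^sub>j\<close>. Multiplying over the \<open>n\<close> columns and taking \<open>n\<close>-th roots keeps both factors.\<close>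

lemma gm_vector_ratio:
  assumes A: "reciprocal_pc_matrix n A" and i: "i < n" and j: "j < n"
  shows "(1 - koczkodaj_index n A) * gm_vector n A $ i \<le> A $$ (i, j) * gm_vector n A $ j"
proof -
  define \<kappa> where "\<kappa> = 1 - koczkodaj_index n A"
  define g where "g l = root n (\<Prod>m<n. A $$ (l, m))" for l
  have pos: "A $$ (l, m) > 0" if "l < n" "m < n" for l m
    using A that by (rule pc_matrix_pos)
  have \<kappa>: "0 < \<kappa>" using koczkodaj_index_less_one[OF A] i by (simp add: \<kappa>_def)
  have triad: "\<kappa> * A $$ (i, m) \<le> A $$ (i, j) * A $$ (j, m)" if "m < n" for m
    using koczkodaj_index_triad(2)[OF i that j, of A] pos i j that
    by (simp add: \<kappa>_def pos_le_divide_eq)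
  have "(\<Prod>m<n. \<kappa> * A $$ (i, m)) \<le> (\<Prod>m<n. A $$ (i, j) * A $$ (j, m))"
    using triad \<kappa> pos i by (intro prod_mono) (auto simp: less_imp_le)
  then have "root n (\<kappa> ^ n * (\<Prod>m<n. A $$ (i, m))) \<le> root n (A $$ (i, j) ^ n * (\<Prod>m<n. A $$ (j, m)))"
    using i by (simp add: prod.distrib)
  then have "\<kappa> * g i \<le> A $$ (i, j) * g j"
    using i j \<kappa> pos by (simp add: g_def real_root_mult real_root_power_cancel less_imp_le)
  moreover have "0 \<le> (\<Sum>l<n. g l)"
    unfolding g_def using pos by (intro sum_nonneg real_root_ge_zero prod_nonneg) (auto simp: less_imp_le)
  ultimately have "\<kappa> * g i / (\<Sum>l<n. g l) \<le> A $$ (i, j) * g j / (\<Sum>l<n. g l)"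
    by (rule divide_right_mono)
  then show ?thesis
    using i j by (simp add: gm_vector_def g_def \<kappa>_def)
qed

text \<open>The entry \<open>a\<^sub>i\<^sub>j\<close> cancels between the two preceding bounds, each of which costs one factor
  \<open>\<kappa>\<close>. The products avoid quotients of \<open>g\<close> by \<open>w\<close>, and can be summed over \<open>i\<close> and \<open>j\<close> as they stand.\<close>

lemma gm_ev_cross_ratio:
  assumes A: "reciprocal_pc_matrix n A" and w: "is_ev_vector n A w"
    and i: "i < n" and j: "j < n"
  shows "gm_vector n A $ i * w $ j
           \<le> 1 / (1 - koczkodaj_index n A)\<^sup>2 * (w $ i * gm_vector n A $ j)"
proof -
  define \<kappa> where "\<kappa> = 1 - koczkodaj_index n A"
  define g where "g = gm_vector n A"
  have \<kappa>: "0 < \<kappa>" using koczkodaj_index_less_one[OF A] i by (simp add: \<kappa>_def)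
  have w_pos: "w $ j > 0" using w j by (simp add: is_ev_vector_def)
  have g_pos: "g $ j > 0" using gm_vector_pos[OF A j] by (simp add: g_def)
  have "\<kappa>\<^sup>2 * (g $ i * w $ j) = \<kappa> * w $ j * (\<kappa> * g $ i)" by (simp add: power2_eq_square)
  also have "\<dots> \<le> \<kappa> * w $ j * (A $$ (i, j) * g $ j)"
    using gm_vector_ratio[OF A i j] \<kappa> w_pos
    by (intro mult_left_mono) (auto simp: g_def \<kappa>_def)
  also have "\<dots> = (\<kappa> * A $$ (i, j) * w $ j) * g $ j" by simp
  also have "\<dots> \<le> w $ i * g $ j"
    using ev_vector_ratio[OF A w i j] g_pos by (intro mult_right_mono) (auto simp: \<kappa>_def)
  finally show ?thesis
    using \<kappa> by (simp add: pos_le_divide_eq mult.commute flip: \<kappa>_def g_def)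
qed

lemma sum_square_ev_gm_le:
  assumes "0 < n" and A: "reciprocal_pc_matrix n A" and w: "is_ev_vector n A w"
  shows "(\<Sum>i<n. (gm_vector n A $ i - w $ i)\<^sup>2) \<le> (1 / (1 - koczkodaj_index n A)\<^sup>2 - 1)\<^sup>2 / 8"
proof (rule sum_square_differences_le)
  have \<kappa>: "0 < 1 - koczkodaj_index n A"
    using koczkodaj_index_less_one[OF A \<open>0 < n\<close>] by simp
  have "A $$ (0, 0) = 1" using A \<open>0 < n\<close> unfolding reciprocal_pc_matrix_def by blast
  then have "1 - koczkodaj_index n A \<le> 1"
    using koczkodaj_index_triad(1)[of 0 n 0 0 A] \<open>0 < n\<close> by simp
  with \<kappa> have "(1 - koczkodaj_index n A)\<^sup>2 \<le> 1"
    by (intro power_le_one) auto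
  then show "1 \<le> 1 / (1 - koczkodaj_index n A)\<^sup>2" using \<kappa> by simp
  show "(\<Sum>i<n. w $ i) = 1" using w by (simp add: is_ev_vector_def)
  show "(\<Sum>i<n. gm_vector n A $ i) = 1" using A \<open>0 < n\<close> by (rule sum_gm_vector)
  show "0 \<le> w $ i" if "i \<in> {..<n}" for i
    using w that by (simp add: is_ev_vector_def less_imp_le)
qed (use gm_ev_cross_ratio[OF A w] in auto)

section \<open>Rankings and numberings\<close>

lemma ordinal_ranking_less:
  assumes "w $ i < w $ j" and "j < n"
  shows "ordinal_ranking n w j < ordinal_ranking n w i"
proof -
  have "{l. l < n \<and> w $ l > w $ j} \<subset> {l. l < n \<and> w $ l > w $ i}"
    using assms by auto
  then show ?thesis
    unfolding ordinal_ranking_def using psubset_card_mono[of "{l. l < n \<and> w $ l > w $ i}"] by simp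
qed

lemma bij_betw_ordinal_ranking:
  assumes "no_ties n w"
  shows "bij_betw (ordinal_ranking n w) {..<n} {1..n}"
proof -
  have inj: "inj_on (ordinal_ranking n w) {..<n}"
  proof (rule inj_onI)
    fix i j assume "i \<in> {..<n}" "j \<in> {..<n}" "ordinal_ranking n w i = ordinal_ranking n w j"
    then show "i = j"
      using ordinal_ranking_less[of w i j n] ordinal_ranking_less[of w j i n] assms
      by (metis inj_onD lessThan_iff linorder_neqE_linordered_idom nat_neq_iff no_ties_def)
  qed
  have "ordinal_ranking n w i \<in> {1..n}" if "i < n" for i
  proof -
    have "{j. j < n \<and> w $ j > w $ i} \<subset> {..<n}" using that by auto
    then have "card {j. j < n \<and> w $ j > w $ i} < n"
      using psubset_card_mono[OF finite_lessThan] by (metis card_lessThan)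
    then show ?thesis by (simp add: ordinal_ranking_def)
  qed
  then have "ordinal_ranking n w ` {..<n} \<subseteq> {1..n}" by blast
  then have "ordinal_ranking n w ` {..<n} = {1..n}"
    using inj by (intro card_subset_eq) (auto simp: card_image)
  with inj show ?thesis by (simp add: bij_betw_def)
qed

lemma decreasing_numbering_gap:
  assumes gap: "\<And>l. l \<in> {1..n - 1} \<Longrightarrow> d \<le> w $ \<pi> l - w $ \<pi> (l + 1)"
    and "1 \<le> l" "l \<le> m" "m \<le> n"
  shows "(real m - real l) * d \<le> w $ \<pi> l - w $ \<pi> m"
  using \<open>l \<le> m\<close> \<open>m \<le> n\<close>
proof (induction m rule: dec_induct)
  case base
  then show ?case by simp
next
  case (step h)
  then have "h \<in> {1..n - 1}" using \<open>1 \<le> l\<close> by auto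
  then show ?case using step gap[of h] by (simp add: algebra_simps)
qed

text \<open>The objects that beat \<open>\<pi> m\<close> are exactly \<open>\<pi> 1, \<dots>, \<pi> (m - 1)\<close>.\<close>

lemma ordinal_ranking_decreasing_numbering:
  assumes num: "decreasing_numbering n w \<pi>" and m: "m \<in> {1..n}"
  shows "ordinal_ranking n w (\<pi> m) = m"
proof -
  have bij: "bij_betw \<pi> {1..n} {..<n}" using num by (simp add: decreasing_numbering_def)
  have desc: "w $ \<pi> b < w $ \<pi> a" if "1 \<le> a" "a < b" "b \<le> n" for a b
    using \<open>a < b\<close> \<open>b \<le> n\<close>
  proof (induction b)
    case 0
    then show ?case by simp
  next
    case (Suc b)
    have "w $ \<pi> (Suc b) < w $ \<pi> b"
      using num Suc.prems \<open>1 \<le> a\<close> by (simp add: decreasing_numbering_def)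
    then show ?case using Suc by (cases "a = b") auto
  qed
  have "{j. j < n \<and> w $ j > w $ \<pi> m} = \<pi> ` {1..<m}"
  proof (intro equalityI subsetI)
    fix j assume j: "j \<in> {j. j < n \<and> w $ j > w $ \<pi> m}"
    then have "j \<in> \<pi> ` {1..n}" by (simp add: bij_betw_imp_surj_on[OF bij] del: One_nat_def)
    then obtain l where l: "l \<in> {1..n}" "j = \<pi> l" by blast
    have "l < m"
      using j l m desc[of m l] by (cases l m rule: linorder_cases) auto
    then show "j \<in> \<pi> ` {1..<m}" using l by auto
  next
    fix j assume "j \<in> \<pi> ` {1..<m}"
    then show "j \<in> {j. j < n \<and> w $ j > w $ \<pi> m}"
      using m desc bij by (auto simp: bij_betw_def)
  qed
  moreover have "inj_on \<pi> {1..<m}"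
    using bij m by (auto simp: bij_betw_def intro: inj_on_subset)
  ultimately show ?thesis using m by (simp add: ordinal_ranking_def card_image)
qed

text \<open>The value \<open>v\<^sub>i\<close> is the weight under \<open>w\<close> at the position where \<open>g\<close> ranks \<open>i\<close>, so \<open>v\<close> is
  ordered like \<open>g\<close> and has the values of \<open>w\<close>. Passing from \<open>w\<close> to \<open>v\<close> through \<open>g\<close> costs at most twice the
  distance of \<open>w\<close> from \<open>g\<close> by the rearrangement inequality, and a shift by one position moves a value
  of \<open>w\<close> by at least \<open>d\<close>.\<close>

lemma rank_displacement_le:
  fixes d :: real
  assumes num: "decreasing_numbering n w \<pi>" and ties: "no_ties n w" "no_ties n g"
    and "0 \<le> d" and gap: "\<And>l. l \<in> {1..n - 1} \<Longrightarrow> d \<le> w $ \<pi> l - w $ \<pi> (l + 1)"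
  shows "d\<^sup>2 * (\<Sum>i<n. (real (ordinal_ranking n w i) - real (ordinal_ranking n g i))\<^sup>2)
           \<le> 4 * (\<Sum>i<n. (g $ i - w $ i)\<^sup>2)"
proof -
  define r where "r = ordinal_ranking n w"
  define s where "s = ordinal_ranking n g"
  define v where "v i = w $ \<pi> (s i)" for i
  \<comment> \<open>the bijection that turns \<open>v\<close> back into \<open>w\<close>\<close>
  define p where "p = inv_into {..<n} s \<circ> r"
  have r: "bij_betw r {..<n} {1..n}" and s: "bij_betw s {..<n} {1..n}"
    unfolding r_def s_def using ties[THEN bij_betw_ordinal_ranking] .
  have r_in: "r i \<in> {1..n}" and s_in: "s i \<in> {1..n}" if "i < n" for i
    using that r s by (auto simp: bij_betw_def)
  have \<pi>_r: "\<pi> (r i) = i" if "i < n" for i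
  proof -
    have "i \<in> \<pi> ` {1..n}"
      using num that bij_betw_imp_surj_on[of \<pi> "{1..n}" "{..<n}"]
      by (simp add: decreasing_numbering_def del: One_nat_def)
    then obtain m where "m \<in> {1..n}" "i = \<pi> m" by blast
    then show ?thesis
      using ordinal_ranking_decreasing_numbering[OF num] by (simp add: r_def)
  qed
  have p: "bij_betw p {..<n} {..<n}"
    unfolding p_def using r s by (blast intro: bij_betw_trans bij_betw_inv_into)
  have v_p: "v (p i) = w $ i" if "i < n" for i
    using r_in[OF that] s that by (simp add: v_def p_def bij_betw_inv_into_right \<pi>_r)
  have w_mono: "(real m - real l) * d \<le> w $ \<pi> l - w $ \<pi> m" if "l \<in> {1..n}" "m \<in> {1..n}" "l \<le> m" for l m
    by (rule decreasing_numbering_gap[of n d w \<pi>, OF gap]) (use that in auto)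
  have sorted: "v i \<le> v j" if ij: "i < n" "j < n" "g $ i \<le> g $ j" for i j
  proof -
    have "s j \<le> s i"
    proof (cases "g $ i = g $ j")
      case True
      then have "i = j" using ties(2) ij by (auto simp: no_ties_def inj_on_def)
      then show ?thesis by simp
    next
      case False
      then show ?thesis using ordinal_ranking_less[of g i j n] ij by (simp add: s_def)
    qed
    then have "0 \<le> (real (s i) - real (s j)) * d" using \<open>0 \<le> d\<close> by simp
    also have "\<dots> \<le> v j - v i" unfolding v_def
      using w_mono[OF s_in s_in] ij \<open>s j \<le> s i\<close> by blast
    finally show ?thesis by simp
  qed
  have close: "(\<Sum>i<n. (g $ i - v i)\<^sup>2) \<le> (\<Sum>i<n. (g $ i - w $ i)\<^sup>2)"
    using rearrangement_inequality_squares[OF _ p, of "\<lambda>i. g $ i" v] sorted v_p by simp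
  have "d\<^sup>2 * (real (r i) - real (s i))\<^sup>2 \<le> 2 * (g $ i - w $ i)\<^sup>2 + 2 * (g $ i - v i)\<^sup>2"
    if "i < n" for i
  proof -
    have "\<bar>(real (r i) - real (s i)) * d\<bar> \<le> \<bar>w $ i - v i\<bar>"
    proof (cases "r i \<le> s i")
      case True
      have "(real (s i) - real (r i)) * d \<le> w $ i - v i"
        using w_mono[OF r_in s_in True] \<pi>_r that by (simp add: v_def)
      moreover have "0 \<le> (real (s i) - real (r i)) * d" using True \<open>0 \<le> d\<close> by simp
      ultimately show ?thesis by (simp add: algebra_simps)
    next
      case False
      then have "(real (r i) - real (s i)) * d \<le> v i - w $ i"
        using w_mono[OF s_in r_in] \<pi>_r that by (simp add: v_def)
      moreover have "0 \<le> (real (r i) - real (s i)) * d" using False \<open>0 \<le> d\<close> by simp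
      ultimately show ?thesis by simp
    qed
    then have "((real (r i) - real (s i)) * d)\<^sup>2 \<le> (w $ i - v i)\<^sup>2"
      by (simp only: abs_le_square_iff)
    \<comment> \<open>\<open>(x + y)\<^sup>2 \<le> 2 x\<^sup>2 + 2 y\<^sup>2\<close> takes the place of the triangle inequality for the norm\<close>
    also have "\<dots> \<le> 2 * (g $ i - w $ i)\<^sup>2 + 2 * (g $ i - v i)\<^sup>2"
      using zero_le_power2[of "(g $ i - w $ i) + (g $ i - v i)"]
      by (simp add: power2_eq_square algebra_simps)
    finally show ?thesis by (simp add: power_mult_distrib mult.commute)
  qed
  then have "d\<^sup>2 * (\<Sum>i<n. (real (r i) - real (s i))\<^sup>2)
      \<le> (\<Sum>i<n. 2 * (g $ i - w $ i)\<^sup>2 + 2 * (g $ i - v i)\<^sup>2)"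
    unfolding sum_distrib_left by (intro sum_mono) simp
  also have "\<dots> \<le> 4 * (\<Sum>i<n. (g $ i - w $ i)\<^sup>2)"
    using close by (simp add: sum.distrib flip: sum_distrib_left)
  finally show ?thesis by (simp add: r_def s_def)
qed

section \<open>The bound on Spearman's rank correlation\<close>

theorem proposition4:
  fixes n k :: nat and A :: "real mat" and w_EV w_GM :: "real vec"
    and \<pi> :: "nat \<Rightarrow> nat" and \<kappa> K d :: real
  assumes "n \<ge> 2"
    and "reciprocal_pc_matrix n A"
    and "\<kappa> = 1 - koczkodaj_index n A"
    and "K = 1 / \<kappa>\<^sup>2 - 1"
    and "is_ev_vector n A w_EV"
    and "w_GM = gm_vector n A"
    and "no_ties n w_EV"
    and "no_ties n w_GM"
    and "decreasing_numbering n w_EV \<pi>"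
    and "d = Min ((\<lambda>i. w_EV $ \<pi> i - w_EV $ \<pi> (i + 1)) ` {1..n - 1})"
    and "k \<le> n choose 2"
    and "real k * d < K"
    and "(real k + 1) * d > K"
  shows "spearman_rho n (ordinal_ranking n w_EV) (ordinal_ranking n w_GM)
           \<ge> 1 - 6 * ((real k)\<^sup>2 + real k) / (real n * ((real n)\<^sup>2 - 1))"
proof -
  \<comment> \<open>an integer, so that \<open>D < 1\<close> forces \<open>D \<le> 0\<close> when \<open>k = 0\<close>\<close>
  define D where "D = (\<Sum>i<n. (int (ordinal_ranking n w_EV i) - int (ordinal_ranking n w_GM i))\<^sup>2)"
  have D: "real_of_int D =
      (\<Sum>i<n. (real (ordinal_ranking n w_EV i) - real (ordinal_ranking n w_GM i))\<^sup>2)"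
    by (simp add: D_def)
  define gaps where "gaps = (\<lambda>i. w_EV $ \<pi> i - w_EV $ \<pi> (i + 1)) ` {1..n - 1}"
  have gaps: "finite gaps" "gaps \<noteq> {}" using \<open>n \<ge> 2\<close> by (auto simp: gaps_def)
  have d_gaps: "d = Min gaps" using assms by (simp add: gaps_def)
  have gap: "d \<le> w_EV $ \<pi> l - w_EV $ \<pi> (l + 1)" if "l \<in> {1..n - 1}" for l
    unfolding d_gaps using gaps(1) by (rule Min_le) (use that in \<open>simp add: gaps_def\<close>)
  have "Min gaps \<in> gaps" using gaps by (rule Min_in)
  then have "0 < d"
    using assms(9) unfolding d_gaps[symmetric] by (auto simp: gaps_def decreasing_numbering_def)
  have "0 \<le> real k * d" using \<open>0 < d\<close> by simp
  then have "0 < K" using \<open>real k * d < K\<close> by linarith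
  have "d\<^sup>2 * D \<le> 4 * (\<Sum>i<n. (w_GM $ i - w_EV $ i)\<^sup>2)"
    unfolding D using assms(9,7,8) less_imp_le[OF \<open>0 < d\<close>] gap by (rule rank_displacement_le)
  also have "\<dots> \<le> 4 * (K\<^sup>2 / 8)"
    using sum_square_ev_gm_le[of n A w_EV] assms(1,2,5) unfolding assms(3,4,6) by simp
  also have "\<dots> < ((real k + 1) * d)\<^sup>2 / 2"
    using power_strict_mono[OF assms(13), of 2] \<open>0 < K\<close> by simp
  finally have "d\<^sup>2 * D < d\<^sup>2 * ((real k + 1)\<^sup>2 / 2)"
    by (simp add: power_mult_distrib mult.commute)
  then have small: "real_of_int D < (real k + 1)\<^sup>2 / 2" using \<open>0 < d\<close> by simp
  have bound: "real_of_int D \<le> (real k)\<^sup>2 + real k"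
  proof (cases "k = 0")
    case True
    then have "real_of_int D < 1" using small by simp
    then have "D \<le> 0" by linarith
    then show ?thesis using True by simp
  next
    case False
    then have "0 \<le> (real k + 1) * (real k - 1)" by (intro mult_nonneg_nonneg) auto
    then have "(real k + 1)\<^sup>2 / 2 \<le> (real k)\<^sup>2 + real k"
      by (simp add: power2_eq_square algebra_simps)
    with small show ?thesis by linarith
  qed
  have "0 < real n * ((real n)\<^sup>2 - 1)"
    using \<open>n \<ge> 2\<close> one_less_power[of "real n" 2] by simp
  then have "6 * real_of_int D / (real n * ((real n)\<^sup>2 - 1))
      \<le> 6 * ((real k)\<^sup>2 + real k) / (real n * ((real n)\<^sup>2 - 1))"
    using bound by (intro divide_right_mono mult_left_mono) auto
  then show ?thesis by (simp add: spearman_rho_def D)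
qed

end
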